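(* Let $(S,\sim,\cdot)$ satisfy axioms A1–A7 (listed in the context), and let $\overrightarrow{S}$ be the set of vectors. Multiplication of a vector by a number has the following properties, for all $\lambda,\mu\in\mathbb{R}$ and all $\overrightarrow{a},\overrightarrow{b}\in\overrightarrow{S}$: 1. $1\cdot\overrightarrow{a}=\overrightarrow{a}$; 2. $(\lambda+\mu)\cdot\overrightarrow{a}=\lambda\cdot\overrightarrow{a}+\mu\cdot\overrightarrow{a}$; 3. $\lambda\cdot(\mu\cdot\overrightarrow{a})=(\lambda\cdot\mu)\cdot\overrightarrow{a}$; 4. $\lambda\cdot(\overrightarrow{a}+\overrightarrow{b})=\lambda\cdot\overrightarrow{a}+\lambda\cdot\overrightarrow{b}$.
   Context: $S$ is a non-empty set whose elements are called points. An ordered pair $(A,B)\in S^2$ is written $AB$ and called an arrow. The primitive notions are a binary relation $\sim$ on $S^2$ and a multiplication $\cdot:\mathbb{R}\times S^2\to S^2$, $(\lambda,AB)\mapsto\lambda\cdot AB$ (also written $\lambda AB$). Addition of arrows: $AB+BC=AC$; more generally $AB+CD=AB+BX=AX$, where $X$ is a point with $BX\sim CD$, provided such a point exists (it is then unique by A2). Axioms (for all points and all real $\lambda,\mu$): A1: $\sim$ is an equivalence relation on $S^2$. A2: $AB\sim AC\Rightarrow B=C$. A3.1: $AB\sim A'B'\Rightarrow BA\sim B'A'$. A3.2: $AB\sim A'B'$ and $BC\sim B'C'$ imply $AC\sim A'C'$. A4: for all $\lambda,A,B$ there is $C$ with $\lambda\cdot AB=AC$. A5: $AB\sim CD\Rightarrow\lambda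 AB\sim\lambda CD$. A6.1: $1\cdot AB=AB$. A6.2: $\lambda\cdot AB+\mu\cdot AB=(\lambda+\mu)\cdot AB$ (in particular the left side is defined). A6.3: $\lambda\cdot(\mu\cdot AB)=(\lambda\mu)\cdot AB$. A7: if $AC=\lambda\cdot AB$ and $AC'=\lambda\cdot AB'$, then $CC'\sim\lambda\cdot BB'$. Vectors: $\overrightarrow{AB}=\{CD : CD\sim AB\}$ is the $\sim$-class of $AB$, and $\overrightarrow{S}$ is the set of all these classes. Addition of vectors: $\overrightarrow{AB}+\overrightarrow{BC}=\overrightarrow{AC}$ (any two vectors can be represented by arrows of the form $AB$, $BC$). Multiplication of a vector by a number: $\lambda\cdot\overrightarrow{AB}=\overrightarrow{\lambda\cdot AB}$. These definitions do not depend on the choice of representing arrows. *)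

theory Defs
  imports Complex_Main
begin

text \<open>
  An arrow \<open>AB\<close> is the pair \<open>(A, B)\<close>; \<open>Sim\<close> is the relation \<open>\<sim>\<close> on arrows, as a set of pairs.
\<close>

text \<open>
  The partial addition of arrows: \<open>AB + CD = AX\<close> for the point \<open>X\<close> with \<open>BX \<sim> CD\<close>,
  and \<open>None\<close> (undefined) if there is no such point. By axioms A1 and A2 there is at most one,
  and \<open>AB + BC = AC\<close> is the case where the second arrow already starts at \<open>B\<close>.
\<close>

definition arrow_add ::
    "'p set \<Rightarrow> (('p \<times> 'p) \<times> ('p \<times> 'p)) set \<Rightarrow> 'p \<times> 'p \<Rightarrow> 'p \<times> 'p \<Rightarrow> ('p \<times> 'p) option"
  where
  "arrow_add S Sim p q =
    (if \<exists>X\<in>S. ((snd p, X), q) \<in> Sim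
     then Some (fst p, THE X. X \<in> S \<and> ((snd p, X), q) \<in> Sim)
     else None)"

locale arrow_space =
  fixes S :: "'p set"
    and Sim :: "(('p \<times> 'p) \<times> ('p \<times> 'p)) set"
    and smul :: "real \<Rightarrow> 'p \<times> 'p \<Rightarrow> 'p \<times> 'p"
  assumes nonempty: "S \<noteq> {}"
    and smul_closed: "p \<in> S \<times> S \<Longrightarrow> smul l p \<in> S \<times> S"
    and A1: "equiv (S \<times> S) Sim"
    and A2: "\<lbrakk>A \<in> S; B \<in> S; C \<in> S; ((A, B), (A, C)) \<in> Sim\<rbrakk> \<Longrightarrow> B = C"
    and A3_1: "\<lbrakk>A \<in> S; B \<in> S; A' \<in> S; B' \<in> S; ((A, B), (A', B')) \<in> Sim\<rbrakk>
      \<Longrightarrow> ((B, A), (B', A')) \<in> Sim"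
    and A3_2: "\<lbrakk>A \<in> S; B \<in> S; C \<in> S; A' \<in> S; B' \<in> S; C' \<in> S;
        ((A, B), (A', B')) \<in> Sim; ((B, C), (B', C')) \<in> Sim\<rbrakk>
      \<Longrightarrow> ((A, C), (A', C')) \<in> Sim"
    and A4: "\<lbrakk>A \<in> S; B \<in> S\<rbrakk> \<Longrightarrow> \<exists>C\<in>S. smul l (A, B) = (A, C)"
    and A5: "\<lbrakk>A \<in> S; B \<in> S; C \<in> S; D \<in> S; ((A, B), (C, D)) \<in> Sim\<rbrakk>
      \<Longrightarrow> (smul l (A, B), smul l (C, D)) \<in> Sim"
    and A6_1: "\<lbrakk>A \<in> S; B \<in> S\<rbrakk> \<Longrightarrow> smul 1 (A, B) = (A, B)"
    and A6_2: "\<lbrakk>A \<in> S; B \<in> S\<rbrakk>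
      \<Longrightarrow> arrow_add S Sim (smul l (A, B)) (smul m (A, B)) = Some (smul (l + m) (A, B))"
    and A6_3: "\<lbrakk>A \<in> S; B \<in> S\<rbrakk> \<Longrightarrow> smul l (smul m (A, B)) = smul (l * m) (A, B)"
    and A7: "\<lbrakk>A \<in> S; B \<in> S; B' \<in> S; C \<in> S; C' \<in> S;
        (A, C) = smul l (A, B); (A, C') = smul l (A, B')\<rbrakk>
      \<Longrightarrow> ((C, C'), smul l (B, B')) \<in> Sim"

definition vectors ::
    "'p set \<Rightarrow> (('p \<times> 'p) \<times> ('p \<times> 'p)) set \<Rightarrow> ('p \<times> 'p) set set"
  where "vectors S Sim = (S \<times> S) // Sim"

text \<open>
  The two operations on vectors are given by their values on representatives; in an
  \<open>arrow_space\<close> representatives exist and the value does not depend on them, so that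
  the descriptions below are proper for all vectors (see the end of this theory).
\<close>

definition vec_add ::
    "(('p \<times> 'p) \<times> ('p \<times> 'p)) set \<Rightarrow> ('p \<times> 'p) set \<Rightarrow> ('p \<times> 'p) set \<Rightarrow> ('p \<times> 'p) set"
  where
  "vec_add Sim a b =
    (THE c. \<exists>A B C. (A, B) \<in> a \<and> (B, C) \<in> b \<and> c = Sim `` {(A, C)})"

definition vec_smul ::
    "(('p \<times> 'p) \<times> ('p \<times> 'p)) set \<Rightarrow> (real \<Rightarrow> 'p \<times> 'p \<Rightarrow> 'p \<times> 'p) \<Rightarrow>
      real \<Rightarrow> ('p \<times> 'p) set \<Rightarrow> ('p \<times> 'p) set"
  where
  "vec_smul Sim smul l a = (THE c. \<exists>p\<in>a. c = Sim `` {smul l p})"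

context arrow_space
begin

lemma Sim_memD: "(p, q) \<in> Sim \<Longrightarrow> p \<in> S \<times> S \<and> q \<in> S \<times> S"
  using A1 by (auto simp: equiv_def)

lemma Sim_refl: "p \<in> S \<times> S \<Longrightarrow> (p, p) \<in> Sim"
  using A1 by (meson equiv_def refl_onD)

lemma Sim_sym: "(p, q) \<in> Sim \<Longrightarrow> (q, p) \<in> Sim"
  using A1 by (meson equiv_def symD)

lemma Sim_trans: "(p, q) \<in> Sim \<Longrightarrow> (q, r) \<in> Sim \<Longrightarrow> (p, r) \<in> Sim"
  using A1 by (meson equiv_def transD)

lemma A6_2D:
  assumes "A \<in> S" "B \<in> S" "smul l (A, B) = (A, C)" "smul m (A, B) = (A, D)"
    "smul (l + m) (A, B) = (A, E)"
  shows "((C, E), (A, D)) \<in> Sim"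
proof -
  have e: "arrow_add S Sim (A, C) (A, D) = Some (A, E)"
    using A6_2[OF assms(1,2), of l m] assms(3-5) by simp
  then obtain X where X: "X \<in> S" "((C, X), (A, D)) \<in> Sim"
    by (auto simp: arrow_add_def split: if_splits)
  have "(THE X. X \<in> S \<and> ((C, X), (A, D)) \<in> Sim) = X"
  proof (rule the_equality)
    fix Y assume Y: "Y \<in> S \<and> ((C, Y), (A, D)) \<in> Sim"
    then have "((C, Y), (C, X)) \<in> Sim"
      using X Sim_sym Sim_trans by blast
    then show "Y = X" using A2 Sim_memD by blast
  qed (use X in blast)
  then show ?thesis using e X by (auto simp: arrow_add_def split: if_splits)
qed

lemma Sim_null:
  assumes "A \<in> S" "X \<in> S" "((X, X), (A, X)) \<in> Sim"
  shows "A = X"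
  using A2[of X A X] A3_1[of X X A X] Sim_trans Sim_sym assms by metis

lemma smul_0:
  assumes "A \<in> S" "B \<in> S"
  shows "smul 0 (A, B) = (A, A)"
proof -
  obtain X where X: "X \<in> S" "smul 0 (A, B) = (A, X)" using A4 assms by blast
  have "((X, X), (A, X)) \<in> Sim" by (rule A6_2D[of A B 0 X 0]) (use X assms in auto)
  then show ?thesis using Sim_null X assms by blast
qed

lemma smul_minus_1:
  assumes "A \<in> S" "B \<in> S"
  shows "(smul (-1) (A, B), (B, A)) \<in> Sim"
proof -
  obtain C where C: "C \<in> S" "smul (-1) (A, B) = (A, C)" using A4 assms by blast
  have "((C, A), (A, B)) \<in> Sim"
    by (rule A6_2D[of A B "-1" C 1]) (use C assms smul_0 A6_1 in auto)
  then show ?thesis using C A3_1 assms by auto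
qed

lemma transport:
  assumes "B \<in> S" "C \<in> S" "D \<in> S"
  shows "\<exists>X\<in>S. ((B, X), (D, C)) \<in> Sim"
proof -
  obtain M where M: "M \<in> S" "smul (1/2) (C, B) = (C, M)" using A4 assms by blast
  have "((M, B), (C, M)) \<in> Sim"
    by (rule A6_2D[of C B "1/2" M "1/2"]) (use M assms A6_1 in auto)
  moreover have "(smul (-1) (M, C), (C, M)) \<in> Sim" using smul_minus_1 M assms by blast
  moreover obtain Z where Z: "Z \<in> S" "smul (-1) (M, C) = (M, Z)" using A4 assms M by blast
  ultimately have B: "smul (-1) (M, C) = (M, B)"
    using A2[of M Z B] Sim_sym Sim_trans M assms by metis
  obtain X where X: "X \<in> S" "smul (-1) (M, D) = (M, X)" using A4 assms M by blast
  have "((B, X), smul (-1) (C, D)) \<in> Sim"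
    by (rule A7[of M C D]) (use X B M assms in auto)
  moreover have "(smul (-1) (C, D), (D, C)) \<in> Sim" using smul_minus_1 assms by blast
  ultimately have "((B, X), (D, C)) \<in> Sim" using Sim_trans by blast
  then show ?thesis using X by blast
qed

lemma vectors_representatives:
  assumes "a \<in> vectors S Sim" "b \<in> vectors S Sim"
  obtains A B C where "A \<in> S" "B \<in> S" "C \<in> S"
    "a = Sim `` {(A, B)}" "b = Sim `` {(B, C)}"
proof -
  obtain A B where a: "A \<in> S" "B \<in> S" "a = Sim `` {(A, B)}"
    using assms(1) by (auto simp: vectors_def quotient_def)
  obtain D E where b: "D \<in> S" "E \<in> S" "b = Sim `` {(D, E)}"
    using assms(2) by (auto simp: vectors_def quotient_def)
  obtain C where C: "C \<in> S" "((B, C), (D, E)) \<in> Sim" using transport a b by blast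
  then have "b = Sim `` {(B, C)}" using equiv_class_eq[OF A1] b by metis
  then show thesis using that a C by blast
qed

lemma vec_add_eq:
  assumes "A \<in> S" "B \<in> S" "C \<in> S"
  shows "vec_add Sim (Sim `` {(A, B)}) (Sim `` {(B, C)}) = Sim `` {(A, C)}"
  unfolding vec_add_def
proof (rule the_equality)
  show "\<exists>A' B' C'. (A', B') \<in> Sim `` {(A, B)} \<and> (B', C') \<in> Sim `` {(B, C)}
      \<and> Sim `` {(A, C)} = Sim `` {(A', C')}"
    using assms Sim_refl by blast
next
  fix c
  assume "\<exists>A' B' C'. (A', B') \<in> Sim `` {(A, B)} \<and> (B', C') \<in> Sim `` {(B, C)}
      \<and> c = Sim `` {(A', C')}"
  then obtain A' B' C' where h: "((A, B), (A', B')) \<in> Sim" "((B, C), (B', C')) \<in> Sim"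
    "c = Sim `` {(A', C')}" by blast
  then have "((A, C), (A', C')) \<in> Sim" using A3_2 Sim_memD by blast
  then show "c = Sim `` {(A, C)}" using equiv_class_eq[OF A1] h by metis
qed

lemma vec_smul_eq:
  assumes "A \<in> S" "B \<in> S"
  shows "vec_smul Sim smul l (Sim `` {(A, B)}) = Sim `` {smul l (A, B)}"
  unfolding vec_smul_def
proof (rule the_equality)
  show "\<exists>p\<in>Sim `` {(A, B)}. Sim `` {smul l (A, B)} = Sim `` {smul l p}"
    using assms Sim_refl by blast
next
  fix c assume "\<exists>p\<in>Sim `` {(A, B)}. c = Sim `` {smul l p}"
  then obtain A' B' where h: "((A, B), (A', B')) \<in> Sim" "c = Sim `` {smul l (A', B')}"
    by auto
  then have "(smul l (A, B), smul l (A', B')) \<in> Sim" using A5 Sim_memD by blast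
  then show "c = Sim `` {smul l (A, B)}" using equiv_class_eq[OF A1] h by metis
qed

end

end

theory Submission
  imports Defs
begin

text \<open>
  Since both operations on vectors can be computed on any representing arrows, it suffices to choose
  the representatives well and read off each law from an axiom. The laws about a single
  vector come from A6.1, A6.2 and A6.3. For distributivity over a sum of vectors, represent the
  summands by \<open>AB\<close> and \<open>BC\<close> and apply the homothety with centre \<open>A\<close> and ratio \<open>\<lambda>\<close>: it sends
  \<open>B\<close> and \<open>C\<close> to points \<open>B'\<close> and \<open>C'\<close>, and A7 (the intercept theorem) says that \<open>B'C'\<close> represents
  \<open>\<lambda> BC\<close>. So \<open>\<lambda> AC = AC'\<close> is the sum of \<open>\<lambda> AB = AB'\<close> and \<open>B'C' \<sim> \<lambda> BC\<close>.
\<close>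

context arrow_space
begin

lemma vec_smul_one:
  assumes "A \<in> S" "B \<in> S"
  shows "vec_smul Sim smul 1 (Sim `` {(A, B)}) = Sim `` {(A, B)}"
  using vec_smul_eq[OF assms] A6_1[OF assms] by simp

text \<open>
  The arrows \<open>\<lambda> AB\<close> and \<open>\<mu> AB\<close> both start at \<open>A\<close>, whereas vectors are added along consecutive
  arrows. A6.2 supplies the translate of the second one to the end point of the first.
\<close>

lemma vec_smul_add_left:
  assumes "A \<in> S" "B \<in> S"
  shows "vec_smul Sim smul (l + m) (Sim `` {(A, B)}) =
    vec_add Sim (vec_smul Sim smul l (Sim `` {(A, B)})) (vec_smul Sim smul m (Sim `` {(A, B)}))"
proof -
  obtain C where C: "C \<in> S" "smul l (A, B) = (A, C)" using A4 assms by blast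
  obtain D where D: "D \<in> S" "smul m (A, B) = (A, D)" using A4 assms by blast
  obtain E where E: "E \<in> S" "smul (l + m) (A, B) = (A, E)" using A4 assms by blast
  have "((C, E), (A, D)) \<in> Sim"
    by (rule A6_2D[OF assms C(2) D(2) E(2)])
  then have "Sim `` {(A, D)} = Sim `` {(C, E)}"
    using equiv_class_eq[OF A1] by metis
  then show ?thesis
    using vec_smul_eq[OF assms] vec_add_eq assms C D E by simp
qed

lemma vec_smul_vec_smul:
  assumes "A \<in> S" "B \<in> S"
  shows "vec_smul Sim smul l (vec_smul Sim smul m (Sim `` {(A, B)})) =
    vec_smul Sim smul (l * m) (Sim `` {(A, B)})"
proof -
  obtain C where C: "C \<in> S" "smul m (A, B) = (A, C)" using A4 assms by blast
  then show ?thesis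
    using vec_smul_eq assms A6_3[OF assms, of l m] by simp
qed

text \<open>
  Scaling about the common starting point \<open>A\<close> of \<open>AB\<close> and \<open>AC\<close> turns the triangle \<open>ABC\<close>
  into a triangle \<open>AB'C'\<close>, whose third side is \<open>\<lambda> BC\<close> by A7.
\<close>

lemma vec_smul_add_right:
  assumes "A \<in> S" "B \<in> S" "C \<in> S"
  shows "vec_smul Sim smul l (vec_add Sim (Sim `` {(A, B)}) (Sim `` {(B, C)})) =
    vec_add Sim (vec_smul Sim smul l (Sim `` {(A, B)})) (vec_smul Sim smul l (Sim `` {(B, C)}))"
proof -
  obtain B' where B': "B' \<in> S" "smul l (A, B) = (A, B')" using A4 assms by blast
  obtain C' where C': "C' \<in> S" "smul l (A, C) = (A, C')" using A4 assms by blast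
  have "((B', C'), smul l (B, C)) \<in> Sim"
    by (rule A7[OF assms B'(1) C'(1) B'(2)[symmetric] C'(2)[symmetric]])
  then have "Sim `` {smul l (B, C)} = Sim `` {(B', C')}"
    using equiv_class_eq[OF A1] by metis
  then show ?thesis
    using vec_smul_eq vec_add_eq assms B' C' by simp
qed

end

theorem theoremW4:
  fixes S :: "'p set"
    and Sim :: "(('p \<times> 'p) \<times> ('p \<times> 'p)) set"
    and smul :: "real \<Rightarrow> 'p \<times> 'p \<Rightarrow> 'p \<times> 'p"
    and l m :: real
    and a b :: "('p \<times> 'p) set"
  assumes "arrow_space S Sim smul"
    and "a \<in> vectors S Sim" and "b \<in> vectors S Sim"
  shows "vec_smul Sim smul 1 a = a
    \<and> vec_smul Sim smul (l + m) a = vec_add Sim (vec_smul Sim smul l a) (vec_smul Sim smul m a)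
    \<and> vec_smul Sim smul l (vec_smul Sim smul m a) = vec_smul Sim smul (l * m) a
    \<and> vec_smul Sim smul l (vec_add Sim a b) = vec_add Sim (vec_smul Sim smul l a) (vec_smul Sim smul l b)"
proof -
  interpret arrow_space S Sim smul by (fact assms(1))
  obtain A B C where "A \<in> S" "B \<in> S" "C \<in> S" "a = Sim `` {(A, B)}" "b = Sim `` {(B, C)}"
    using vectors_representatives[OF assms(2,3)] .
  then show ?thesis
    using vec_smul_one vec_smul_add_left vec_smul_vec_smul vec_smul_add_right by simp
qed

end
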